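(* Fix $\nu>0$ and let $X,Y\in\mathcal{F}_\nu$ be independent. Then $X+Y\in\mathcal{F}_\nu$ if and only if $X$ and $Y$ are Poisson distributed.
   Context: For $\lambda,\nu>0$, $X\sim\mathrm{CMP}(\lambda,\nu)$ (COM-Poisson distribution of order $\nu$) means $P(X=k)=\frac{\lambda^k}{(k!)^\nu}\cdot\frac{1}{Z(\lambda,\nu)}$ for $k=0,1,2,\dots$, where $Z(\lambda,\nu)=\sum_{i=0}^\infty\frac{\lambda^i}{(i!)^\nu}$. For fixed $\nu>0$, $\mathcal{F}_\nu$ is the family of COM-Poisson random variables of order $\nu$: $X\in\mathcal{F}_\nu$ iff $X\sim\mathrm{CMP}(\lambda,\nu)$ for some $\lambda>0$. *)

theory Defs
  imports "HOL-Probability.Probability" "HOL-Real_Asymp.Real_Asymp"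
begin

(* The rate parameter, usually written lambda, is called \<theta> here. *)

definition cmp_Z :: "real \<Rightarrow> real \<Rightarrow> real" where
  "cmp_Z \<theta> \<nu> = (\<Sum>i. \<theta> ^ i / (fact i) powr \<nu>)"

lemma summable_cmp_Z:
  fixes \<theta> \<nu> :: real
  assumes "\<theta> > 0" "\<nu> > 0"
  shows "summable (\<lambda>i. \<theta> ^ i / (fact i) powr \<nu>)"
proof -
  have "filterlim (\<lambda>n. (real n) powr \<nu>) at_top sequentially"
    using assms by real_asymp
  then have "\<forall>\<^sub>F n in sequentially. real n powr \<nu> \<ge> 2 * \<theta>"
    by (simp add: filterlim_at_top)
  then obtain N where N: "\<And>n. n \<ge> N \<Longrightarrow> real n powr \<nu> \<ge> 2 * \<theta>"
    by (auto simp: eventually_sequentially)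
  show ?thesis
  proof (rule summable_ratio_test[where c = "1/2" and N = N])
    fix n assume "N \<le> n"
    then have "real (Suc n) powr \<nu> \<ge> 2 * \<theta>" by (intro N) simp
    then have *: "\<theta> / real (Suc n) powr \<nu> \<le> 1/2" by (simp add: field_simps)
    have "norm (\<theta> ^ Suc n / (fact (Suc n)) powr \<nu>)
        = (\<theta> / real (Suc n) powr \<nu>) * norm (\<theta> ^ n / (fact n) powr \<nu>)"
      using assms unfolding fact_Suc by (simp add: powr_mult del: of_nat_Suc)
    also have "\<dots> \<le> 1/2 * norm (\<theta> ^ n / (fact n) powr \<nu>)"
      by (rule mult_right_mono[OF *]) simp
    finally show "norm (\<theta> ^ Suc n / (fact (Suc n)) powr \<nu>) \<le> 1/2 * norm (\<theta> ^ n / (fact n) powr \<nu>)" .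
  qed simp
qed

definition cmp_distributed :: "'a measure \<Rightarrow> ('a \<Rightarrow> nat) \<Rightarrow> real \<Rightarrow> real \<Rightarrow> bool" where
  "cmp_distributed M X \<theta> \<nu> \<longleftrightarrow>
     X \<in> measurable M (count_space UNIV) \<and>
     (\<forall>k. measure M {\<omega> \<in> space M. X \<omega> = k} = \<theta> ^ k / (fact k) powr \<nu> * (1 / cmp_Z \<theta> \<nu>))"

definition cmp_family :: "'a measure \<Rightarrow> real \<Rightarrow> ('a \<Rightarrow> nat) set" where
  "cmp_family M \<nu> = {X. \<exists>\<theta>>0. cmp_distributed M X \<theta> \<nu>}"

(* The degenerate rate 0 is not counted as Poisson, and poisson_pmf r is only meaningful for r > 0. *)

definition poisson_distributed :: "'a measure \<Rightarrow> ('a \<Rightarrow> nat) \<Rightarrow> bool" where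
  "poisson_distributed M X \<longleftrightarrow>
     X \<in> measurable M (count_space UNIV) \<and>
     (\<exists>r>0. distr M (count_space UNIV) X = measure_pmf (poisson_pmf r))"

end

theory Submission
  imports Defs
begin

text \<open>
  Write \<open>a\<close>, \<open>b\<close> for the rates of \<open>X\<close> and \<open>Y\<close>. Convolving the two mass functions gives
  \<open>P(X + Y = k) = S k / ((k!)\<^sup>\<nu> Z(a,\<nu>) Z(b,\<nu>))\<close>, where
  \<open>S k = (\<Sum>i\<le>k. (k choose i)\<^sup>\<nu> a\<^sup>i b\<^bsup>k-i\<^esup>)\<close> is a binomial sum with distorted coefficients
  (\<open>cmp_convolution\<close>). So \<open>X + Y\<close> has order \<open>\<nu>\<close> and rate \<open>\<theta>\<close> exactly when \<open>S k\<close> is a constant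
  multiple of \<open>\<theta>\<^sup>k\<close>. The values at \<open>k = 0, 1, 2\<close> already force
  \<open>a\<^sup>2 + 2\<^sup>\<nu> a b + b\<^sup>2 = (a + b)\<^sup>2\<close>, hence \<open>\<nu> = 1\<close>; and for \<open>\<nu> = 1\<close> the binomial theorem
  shows that \<open>X + Y\<close> has rate \<open>a + b\<close>.

  It remains to see that, for variables of order \<open>\<nu>\<close>, being Poisson means the same as \<open>\<nu> = 1\<close>.
  Order one is the Poisson law because \<open>Z(\<theta>,1)\<close> is the exponential series
  (\<open>cmp_distributed_1_iff_poisson\<close>), and the order is determined by the distribution
  (\<open>cmp_order_unique\<close>).
\<close>

lemma cmp_Z_pos:
  assumes "\<theta> > 0" "\<nu> > 0"
  shows "cmp_Z \<theta> \<nu> > 0"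
  unfolding cmp_Z_def
  using assms by (intro suminf_pos summable_cmp_Z) (auto intro!: divide_pos_pos)

lemma cmp_Z_1: "cmp_Z \<theta> 1 = exp \<theta>"
  unfolding cmp_Z_def exp_def by (simp add: field_simps)

text \<open>
  The probabilities of \<open>0\<close>, \<open>1\<close>, \<open>2\<close> successively reveal the normalising constant, the rate and
  \<open>2\<^sup>\<nu>\<close>.
\<close>

lemma cmp_order_unique:
  assumes X: "cmp_distributed M X a \<mu>" "cmp_distributed M X b \<nu>"
    and pos: "a > 0" "\<mu> > 0" "b > 0" "\<nu> > 0"
  shows "\<mu> = \<nu>"
proof -
  have eq: "a ^ k / (fact k) powr \<mu> * (1 / cmp_Z a \<mu>) = b ^ k / (fact k) powr \<nu> * (1 / cmp_Z b \<nu>)" for k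
    using X by (simp add: cmp_distributed_def)
  have Z: "cmp_Z a \<mu> = cmp_Z b \<nu>" "cmp_Z b \<nu> \<noteq> 0"
    using eq[of 0] cmp_Z_pos[of b \<nu>] pos by auto
  have "a = b"
    using eq[of 1] Z by simp
  then have "2 powr \<mu> = (2::real) powr \<nu>"
    using eq[of 2] Z pos by (simp add: field_simps)
  then show ?thesis
    by (subst (asm) powr_inj) auto
qed

lemma cmp_distributed_1_iff_poisson:
  assumes "\<theta> > 0"
  shows "cmp_distributed M X \<theta> 1 \<longleftrightarrow> X \<in> measurable M (count_space UNIV) \<and>
    distr M (count_space UNIV) X = measure_pmf (poisson_pmf \<theta>)"
proof (cases "X \<in> measurable M (count_space UNIV)")
  case meas: True
  have pr: "measure M {\<omega> \<in> space M. X \<omega> = k} = measure (distr M (count_space UNIV) X) {k}" for k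
    using meas by (subst measure_distr) (auto intro!: arg_cong[where f = "measure M"])
  have mass: "\<theta> ^ k / (fact k) powr 1 * (1 / cmp_Z \<theta> 1) = measure (measure_pmf (poisson_pmf \<theta>)) {k}" for k
    using assms by (simp add: cmp_Z_1 measure_pmf_single exp_minus field_simps)
  have "distr M (count_space UNIV) X = measure_pmf (poisson_pmf \<theta>)"
    if eq: "\<And>k. measure (distr M (count_space UNIV) X) {k} = measure (measure_pmf (poisson_pmf \<theta>)) {k}"
  proof (rule measure_eqI_countable[of _ UNIV])
    fix k :: nat
    \<comment> \<open>\<open>measure\<close> is \<open>0\<close> on sets of infinite \<open>emeasure\<close>, so positivity of the Poisson masses
        supplies finiteness.\<close>
    have "measure (distr M (count_space UNIV) X) {k} > 0"
      unfolding eq using assms by (simp add: measure_pmf_single)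
    then have "emeasure (distr M (count_space UNIV) X) {k} \<noteq> \<infinity>"
      by (auto simp: measure_def)
    then show "emeasure (distr M (count_space UNIV) X) {k} = emeasure (measure_pmf (poisson_pmf \<theta>)) {k}"
      by (simp add: emeasure_eq_ennreal_measure eq measure_pmf.emeasure_eq_measure)
  qed auto
  then show ?thesis
    using meas unfolding cmp_distributed_def pr mass by auto
qed (simp add: cmp_distributed_def)

lemma (in prob_space) prob_indep_sum_nat:
  fixes X Y :: "'a \<Rightarrow> nat"
  assumes ind: "indep_var (count_space UNIV) X (count_space UNIV) Y"
  shows "prob {\<omega> \<in> space M. X \<omega> + Y \<omega> = k} =
    (\<Sum>i\<le>k. prob {\<omega> \<in> space M. X \<omega> = i} * prob {\<omega> \<in> space M. Y \<omega> = k - i})"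
proof -
  define A where "A i = {\<omega> \<in> space M. X \<omega> = i \<and> Y \<omega> = k - i}" for i
  have [measurable]: "X \<in> measurable M (count_space UNIV)" "Y \<in> measurable M (count_space UNIV)"
    using indep_var_rv1[OF ind] indep_var_rv2[OF ind] by auto
  have "{\<omega> \<in> space M. X \<omega> + Y \<omega> = k} = (\<Union>i\<le>k. A i)"
    by (auto simp: A_def)
  moreover have "prob (\<Union>i\<le>k. A i) = (\<Sum>i\<le>k. prob (A i))"
    by (intro finite_measure_finite_Union) (auto simp: A_def disjoint_family_on_def)
  moreover have "prob (A i) = prob {\<omega> \<in> space M. X \<omega> = i} * prob {\<omega> \<in> space M. Y \<omega> = k - i}" for i
    using indep_varD[OF ind, of "{i}" "{k - i}"]
    by (simp add: A_def vimage_def Int_def conj_commute)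
  ultimately show ?thesis
    by simp
qed

text \<open>
  The weights \<open>1 / (i!)\<^sup>\<nu>\<close> and \<open>1 / ((k - i)!)\<^sup>\<nu>\<close> multiply to \<open>(k choose i)\<^sup>\<nu> / (k!)\<^sup>\<nu>\<close>, so everything
  that varies with \<open>i\<close> sits in the distorted binomial sum.
\<close>

lemma (in prob_space) cmp_convolution:
  assumes ind: "indep_var (count_space UNIV) X (count_space UNIV) Y"
    and X: "cmp_distributed M X a \<nu>" and Y: "cmp_distributed M Y b \<nu>"
  shows "prob {\<omega> \<in> space M. X \<omega> + Y \<omega> = k} =
    (\<Sum>i\<le>k. real (k choose i) powr \<nu> * a ^ i * b ^ (k - i)) / ((fact k) powr \<nu> * (cmp_Z a \<nu> * cmp_Z b \<nu>))"
proof -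
  have "prob {\<omega> \<in> space M. X \<omega> = i} * prob {\<omega> \<in> space M. Y \<omega> = k - i} =
      real (k choose i) powr \<nu> * a ^ i * b ^ (k - i) / ((fact k) powr \<nu> * (cmp_Z a \<nu> * cmp_Z b \<nu>))"
    if "i \<le> k" for i
    using X Y that by (simp add: cmp_distributed_def binomial_fact powr_divide powr_mult)
  then show ?thesis
    by (simp add: prob_indep_sum_nat[OF ind] sum_divide_distrib)
qed

text \<open>
  The value at \<open>k = 0\<close> equates the normalising constants, \<open>k = 1\<close> gives \<open>\<theta> = a + b\<close>, and at \<open>k = 2\<close>
  the middle binomial coefficient \<open>2\<close> appears as \<open>2\<^sup>\<nu>\<close>: the first place where \<open>\<nu>\<close> shows.
\<close>

lemma (in prob_space) cmp_sum_imp_order_1: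
  assumes ind: "indep_var (count_space UNIV) X (count_space UNIV) Y"
    and X: "cmp_distributed M X a \<nu>" and Y: "cmp_distributed M Y b \<nu>"
    and S: "cmp_distributed M (\<lambda>\<omega>. X \<omega> + Y \<omega>) \<theta> \<nu>"
    and pos: "a > 0" "b > 0" "\<theta> > 0" "\<nu> > 0"
  shows "\<nu> = 1"
proof -
  have eq: "(\<Sum>i\<le>k. real (k choose i) powr \<nu> * a ^ i * b ^ (k - i)) / (cmp_Z a \<nu> * cmp_Z b \<nu>)
      = \<theta> ^ k / cmp_Z \<theta> \<nu>" for k
  proof -
    have "prob {\<omega> \<in> space M. X \<omega> + Y \<omega> = k} = \<theta> ^ k / (fact k) powr \<nu> * (1 / cmp_Z \<theta> \<nu>)"
      using S by (simp add: cmp_distributed_def)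
    from arg_cong[OF this, of "\<lambda>p. (fact k) powr \<nu> * p"] show ?thesis
      unfolding cmp_convolution[OF ind X Y] by simp
  qed
  have Z: "cmp_Z a \<nu> * cmp_Z b \<nu> = cmp_Z \<theta> \<nu>" "cmp_Z \<theta> \<nu> \<noteq> 0"
    using eq[of 0] cmp_Z_pos[of \<theta> \<nu>] pos by auto
  have "a + b = \<theta>"
    using eq[of 1] Z by (simp add: add.commute)
  moreover have "b\<^sup>2 + 2 powr \<nu> * a * b + a\<^sup>2 = \<theta>\<^sup>2"
    using eq[of 2] Z by (simp add: numeral_2_eq_2)
  ultimately have "2 powr \<nu> * (a * b) = 2 * (a * b)"
    by (auto simp: power2_eq_square algebra_simps)
  then have "2 powr \<nu> = (2::real) powr 1"
    using pos by simp
  then show ?thesis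
    by (subst (asm) powr_inj) auto
qed

lemma (in prob_space) cmp_sum_order_1:
  assumes ind: "indep_var (count_space UNIV) X (count_space UNIV) Y"
    and X: "cmp_distributed M X a 1" and Y: "cmp_distributed M Y b 1"
  shows "cmp_distributed M (\<lambda>\<omega>. X \<omega> + Y \<omega>) (a + b) 1"
proof -
  have [measurable]: "X \<in> measurable M (count_space UNIV)" "Y \<in> measurable M (count_space UNIV)"
    using X Y by (auto simp: cmp_distributed_def)
  have "(\<lambda>\<omega>. X \<omega> + Y \<omega>) \<in> measurable M (count_space UNIV)"
    by measurable
  then show ?thesis
    unfolding cmp_distributed_def cmp_convolution[OF ind X Y]
    by (simp add: cmp_Z_1 exp_add binomial_ring)
qed

theorem corollary4p3:
  fixes M :: "'a measure" and X Y :: "'a \<Rightarrow> nat" and \<nu> :: real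
  assumes "prob_space M"
    and "\<nu> > 0"
    and "X \<in> cmp_family M \<nu>" and "Y \<in> cmp_family M \<nu>"
    and "prob_space.indep_var M (count_space UNIV) X (count_space UNIV) Y"
  shows "(\<lambda>\<omega>. X \<omega> + Y \<omega>) \<in> cmp_family M \<nu> \<longleftrightarrow>
    poisson_distributed M X \<and> poisson_distributed M Y"
proof -
  interpret prob_space M by fact
  note ind = assms(5)
  obtain a b where X: "a > 0" "cmp_distributed M X a \<nu>" and Y: "b > 0" "cmp_distributed M Y b \<nu>"
    using assms by (auto simp: cmp_family_def)
  have poisson_iff: "poisson_distributed M V \<longleftrightarrow> (\<exists>r>0. cmp_distributed M V r 1)" for V
    by (auto simp: poisson_distributed_def cmp_distributed_1_iff_poisson)
  show ?thesis
  proof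
    assume "(\<lambda>\<omega>. X \<omega> + Y \<omega>) \<in> cmp_family M \<nu>"
    then obtain \<theta> where "\<theta> > 0" "cmp_distributed M (\<lambda>\<omega>. X \<omega> + Y \<omega>) \<theta> \<nu>"
      by (auto simp: cmp_family_def)
    then have "\<nu> = 1"
      using cmp_sum_imp_order_1[OF ind] X Y assms(2) by blast
    then show "poisson_distributed M X \<and> poisson_distributed M Y"
      using X Y by (auto simp: poisson_iff)
  next
    assume "poisson_distributed M X \<and> poisson_distributed M Y"
    then have "\<nu> = 1"
      using cmp_order_unique[OF X(2)] X(1) assms(2) by (auto simp: poisson_iff)
    then show "(\<lambda>\<omega>. X \<omega> + Y \<omega>) \<in> cmp_family M \<nu>"
      using cmp_sum_order_1[OF ind] X Y by (auto simp: cmp_family_def intro!: exI[of _ "a + b"])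
  qed
qed

end
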